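(* Let $\rho_n,\rho_m>0$, $R_0>0$, $0<\eta\le 1$, let $h_n,h_m\in\mathbb{C}$ with $h_n\neq 0$, and set $\epsilon_0=2^{R_0}-1$ and $\tau_m=\max\{0,\ \rho_m|h_m|^2/\epsilon_0-1\}$. Consider the optimization problem $$\max_{\beta_1,\beta_2\in[0,1]}\ \log\left(1+\beta_1\rho_n|h_n|^2\right)+\log\left(1+\beta_2\rho_n|h_n|^2\right)\quad\text{s.t.}\quad \beta_1+\beta_2\le\eta,\qquad \beta_1\rho_n|h_n|^2\le\tau_m .$$ Then the optimal solution $(\beta_1^*,\beta_2^* )$ of this problem is given by $$\beta_1^*=\begin{cases}0, & \tau_m=0,\\[2pt] \dfrac{\eta}{2}, & \tau_m>0\ \text{and}\ \dfrac{\tau_m}{\rho_n|h_n|^2}\ge\dfrac{\eta}{2},\\[6pt] \dfrac{\tau_m}{\rho_n|h_n|^2}, & \tau_m>0\ \text{and}\ \dfrac{\tau_m}{\rho_n|h_n|^2}<\dfrac{\eta}{2},\end{cases}$$ and $\beta_2^*=\eta-\beta_1^*$.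
   Context: Here $\log$ is the logarithm to base 2. The setting is a two-user uplink with users $U_m$ and $U_n$, transmit powers $\rho_m,\rho_n$, channel coefficients $h_m,h_n$, and unit noise power. User $U_m$ has target data rate $R_0$. User $U_n$ transmits with power $\beta_1\rho_n$ in $U_m$'s time slot and with power $\beta_2\rho_n$ in its own time slot, and the objective is its total data rate. The quantity $\tau_m$ is the maximal interference power under which $U_m$'s signal can still be decoded at rate $R_0$, and $\eta$ bounds the total energy used by $U_n$ relative to orthogonal transmission with full power. *)

theory Defs
  imports Complex_Main
begin

definition snr_threshold :: "real \<Rightarrow> real" where
  "snr_threshold R0 = 2 powr R0 - 1"

definition interference_cap :: "real \<Rightarrow> complex \<Rightarrow> real \<Rightarrow> real" where
  "interference_cap \<rho>m hm R0 = max 0 (\<rho>m * (cmod hm)\<^sup>2 / snr_threshold R0 - 1)"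

definition total_rate :: "real \<Rightarrow> complex \<Rightarrow> real \<times> real \<Rightarrow> real" where
  "total_rate \<rho>n hn = (\<lambda>(\<beta>1, \<beta>2).
     log 2 (1 + \<beta>1 * \<rho>n * (cmod hn)\<^sup>2) + log 2 (1 + \<beta>2 * \<rho>n * (cmod hn)\<^sup>2))"

definition feasible :: "real \<Rightarrow> complex \<Rightarrow> real \<Rightarrow> real \<Rightarrow> real \<times> real \<Rightarrow> bool" where
  "feasible \<rho>n hn \<eta> \<tau>m = (\<lambda>(\<beta>1, \<beta>2).
     \<beta>1 \<in> {0..1} \<and> \<beta>2 \<in> {0..1} \<and> \<beta>1 + \<beta>2 \<le> \<eta> \<and> \<beta>1 * \<rho>n * (cmod hn)\<^sup>2 \<le> \<tau>m)"

(* In the last two branches \<tau>m is positive whenever it is a value of interference_cap,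
   which is nonnegative by construction. *)
definition \<beta>1_opt :: "real \<Rightarrow> complex \<Rightarrow> real \<Rightarrow> real \<Rightarrow> real" where
  "\<beta>1_opt \<rho>n hn \<eta> \<tau>m =
     (if \<tau>m = 0 then 0
      else if \<tau>m / (\<rho>n * (cmod hn)\<^sup>2) \<ge> \<eta> / 2 then \<eta> / 2
      else \<tau>m / (\<rho>n * (cmod hn)\<^sup>2))"

end

(* On the line \<beta>1 + \<beta>2 = \<eta> the product of the two SNR factors is a concave quadratic in \<beta>1, symmetric
   about \<eta>/2, and any point below that line is improved by raising \<beta>2.  So the unique maximiser has
   \<beta>1 as close to \<eta>/2 as the cap \<tau>m / (\<rho>n |hn|^2) permits. *)
theory Submission
  imports Defs
begin

text \<open>Strict domination by \<open>a\<close> yields existence and uniqueness of the maximiser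
  at once, with no compactness or calculus.\<close>

lemma Collect_is_arg_max_eq_singleton:
  fixes f :: "'a \<Rightarrow> 'b::order"
  assumes "P a" and "\<And>x. P x \<Longrightarrow> x \<noteq> a \<Longrightarrow> f x < f a"
  shows "{x. is_arg_max f P x} = {a}"
  using assms by (auto simp: is_arg_max_def) (metis less_asym)

text \<open>The branch \<open>\<tau>m = 0\<close> is absorbed by the minimum, since the quotient is
  then 0, which lies below \<open>\<eta> / 2\<close>.\<close>

lemma \<beta>1_opt_eq_min:
  assumes "0 < \<rho>n * (cmod hn)\<^sup>2" and "0 < \<eta>"
  shows "\<beta>1_opt \<rho>n hn \<eta> \<tau>m = min (\<eta> / 2) (\<tau>m / (\<rho>n * (cmod hn)\<^sup>2))"
  using assms by (auto simp: \<beta>1_opt_def min_def)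

text \<open>The disjunction encodes the cap: either \<open>b\<close> bounds \<open>x\<close>, or
  \<open>b\<close> is already the midpoint, and then \<open>x\<close> may lie on either side of
  it.\<close>

lemma snr_product_less:
  fixes b g x y \<eta> :: real
  assumes "0 < g" and "0 \<le> x" and "x + y \<le> \<eta>"
    and "b \<le> \<eta> / 2" and "x \<le> b \<or> b = \<eta> / 2"
    and "(x, y) \<noteq> (b, \<eta> - b)"
  shows "(1 + x * g) * (1 + y * g) < (1 + b * g) * (1 + (\<eta> - b) * g)"
proof -
  have pos: "0 < 1 + x * g"
    using assms(1,2) by (simp add: add_pos_nonneg)
  \<comment> \<open>First summand: gain from raising \<open>y\<close> to \<open>\<eta> - x\<close>.
    Second: gain from then sliding \<open>x\<close> to \<open>b\<close> along the budget
    line.\<close>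
  have diff: "(1 + b * g) * (1 + (\<eta> - b) * g) - (1 + x * g) * (1 + y * g)
      = (1 + x * g) * ((\<eta> - x - y) * g) + g\<^sup>2 * ((b - x) * (\<eta> - b - x))"
    by (simp add: algebra_simps power2_eq_square)
  show ?thesis
  proof (cases "x = b")
    case True
    \<comment> \<open>With \<open>x = b\<close> the pairs can differ only in \<open>y\<close>, so
      the budget is not exhausted.\<close>
    with assms(3,6) have "0 < (\<eta> - x - y) * g"
      using assms(1) by auto
    with pos have "0 < (1 + x * g) * ((\<eta> - x - y) * g)"
      by (rule mult_pos_pos)
    moreover have "g\<^sup>2 * ((b - x) * (\<eta> - b - x)) = 0"
      using True by simp
    ultimately show ?thesis
      using diff by linarith
  next
    case False
    \<comment> \<open>Either this is the square of the nonzero \<open>b - x\<close>, or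
      \<open>x < b < \<eta> / 2\<close> makes both factors positive.\<close>
    have "0 < (b - x) * (\<eta> - b - x)"
    proof (cases "b = \<eta> / 2")
      case True
      then have "\<eta> - b - x = b - x"
        by simp
      with False show ?thesis
        by (simp add: zero_less_mult_iff) linarith
    next
      case b: False
      with False assms(4,5) show ?thesis
        by (intro mult_pos_pos) auto
    qed
    then have "0 < g\<^sup>2 * ((b - x) * (\<eta> - b - x))"
      using assms(1) by simp
    moreover have "0 \<le> (1 + x * g) * ((\<eta> - x - y) * g)"
      using pos assms(1,3) by simp
    ultimately show ?thesis
      using diff by linarith
  qed
qed

lemma total_rate_eq_log_product:
  assumes "0 \<le> \<rho>n" and "0 \<le> x" and "0 \<le> y"
  shows "total_rate \<rho>n hn (x, y)
    = log 2 ((1 + x * (\<rho>n * (cmod hn)\<^sup>2)) * (1 + y * (\<rho>n * (cmod hn)\<^sup>2)))"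
proof -
  have "0 < 1 + z * (\<rho>n * (cmod hn)\<^sup>2)" if "0 \<le> z" for z
    using assms(1) that by (simp add: add_pos_nonneg)
  with assms(2,3) show ?thesis
    by (simp add: total_rate_def log_mult_pos mult.assoc)
qed

theorem lemma1:
  fixes \<rho>n \<rho>m R0 \<eta> \<tau>m :: real and hn hm :: complex
  assumes "\<rho>n > 0" and "\<rho>m > 0" and "R0 > 0" and "0 < \<eta>" and "\<eta> \<le> 1"
    and "hn \<noteq> 0"
    and "\<tau>m = interference_cap \<rho>m hm R0"
  shows "{\<beta>. is_arg_max (total_rate \<rho>n hn) (feasible \<rho>n hn \<eta> \<tau>m) \<beta>}
           = {(\<beta>1_opt \<rho>n hn \<eta> \<tau>m, \<eta> - \<beta>1_opt \<rho>n hn \<eta> \<tau>m)}"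
proof -
  define g where "g = \<rho>n * (cmod hn)\<^sup>2"
  define b where "b = \<beta>1_opt \<rho>n hn \<eta> \<tau>m"
  have g: "0 < g"
    using assms(1,6) by (simp add: g_def)
  have \<tau>: "0 \<le> \<tau>m"
    using assms(7) by (simp add: interference_cap_def)
  have b: "b = min (\<eta> / 2) (\<tau>m / g)"
    using \<beta>1_opt_eq_min g assms(4) by (simp add: b_def g_def)
  have b_bounds: "0 \<le> b" "b \<le> \<eta> / 2" "b * g \<le> \<tau>m"
    using b g \<tau> assms(4) by (auto simp: min_def field_simps)
  have feas_opt: "feasible \<rho>n hn \<eta> \<tau>m (b, \<eta> - b)"
    using b_bounds assms(4,5) by (simp add: feasible_def g_def mult.assoc)
  have less: "total_rate \<rho>n hn p < total_rate \<rho>n hn (b, \<eta> - b)"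
    if feas: "feasible \<rho>n hn \<eta> \<tau>m p" and ne: "p \<noteq> (b, \<eta> - b)" for p
  proof -
    obtain x y where p: "p = (x, y)"
      by fastforce
    with feas have xy: "0 \<le> x" "0 \<le> y" "x + y \<le> \<eta>" "x * g \<le> \<tau>m"
      by (simp_all add: feasible_def g_def mult.assoc)
    \<comment> \<open>If the minimum defining \<open>b\<close> is not \<open>\<eta> / 2\<close>, it
      is \<open>\<tau>m / g\<close>, and the interference constraint says
      \<open>x \<le> \<tau>m / g\<close>.\<close>
    have "x \<le> b \<or> b = \<eta> / 2"
      using b xy(4) g by (auto simp: min_def pos_le_divide_eq)
    then have "(1 + x * g) * (1 + y * g) < (1 + b * g) * (1 + (\<eta> - b) * g)"
      using snr_product_less[of g x y \<eta> b] g xy b_bounds ne p by simp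
    moreover have "0 < (1 + x * g) * (1 + y * g)"
      using xy g by (intro mult_pos_pos add_pos_nonneg) auto
    ultimately have "log 2 ((1 + x * g) * (1 + y * g)) < log 2 ((1 + b * g) * (1 + (\<eta> - b) * g))"
      by simp
    then show ?thesis
      using p xy b_bounds assms(1,4) by (simp add: total_rate_eq_log_product g_def)
  qed
  show ?thesis
    unfolding b_def[symmetric] using feas_opt less by (rule Collect_is_arg_max_eq_singleton)
qed

end
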